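(* Let $R$ be a Noetherian ring and $E$ a finitely generated torsionfree $R$-module of rank $e>0$ with $E\subseteq G\cong R^e$. The following are equivalent: (a) $\operatorname{grade}(G/E)\ge2$; (b) $\operatorname{grade}(G/U)\ge2$ for every reduction $U$ of $E$; (c) $\operatorname{grade}(G/U)\ge 2$ for some reduction $U$ of $E$. If these hold, then for every reduction $U$ of $E$, $V(F_e(E))=V(F_e(U))=\operatorname{Supp}(G/E)=\operatorname{Supp}(G/U)$, and in particular $\operatorname{grade}(G/E)=\operatorname{grade}F_e(E)=\operatorname{grade}F_e(U)=\operatorname{grade}(G/U)$.
   Context: All rings are commutative and Noetherian. A finitely generated module has rank $e$ if $E\otimes_RQ\cong Q^e$, $Q$ the total ring of fractions. For $E$ finitely generated torsionfree of rank $e>0$ with $E\subseteq G=R^e$, the Rees algebra $\mathcal R(E)$ is the $R$-subalgebra of $R[t_1,\dots,t_e]$ generated by the linear forms $a_1t_1+\dots+a_et_e$, $(a_1,\dots,a_e)\in E$, and $E^n$ is its degree-$n$ component. A submodule $U\subseteq E$ is a reduction of $E$ if $E^{r+1}=U\cdot E^r$ in $\mathcal R(E)$ for some $r\ge0$ (a reduction again has rank $e$). $F_i(E)$ is the $i$-th Fitting ideal (generated by the $(n-i)$-minors of a presentation matrix $R^m\to R^n$ of $E$). For a finitely generated module $M$, $\operatorname{grade}M$ is the grade of $\operatorname{ann}_RM$ ($\infty$ if $M=0$). *)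

theory Defs
  imports "HOL-Library.Poly_Mapping" "HOL-Library.Extended_Nat" "HOL-Library.Function_Algebras" "Jordan_Normal_Form.Determinant"
begin

definition is_ideal :: "'a::comm_ring_1 set \<Rightarrow> bool" where
  "is_ideal I \<longleftrightarrow> 0 \<in> I \<and> (\<forall>x\<in>I. \<forall>y\<in>I. x + y \<in> I) \<and> (\<forall>r. \<forall>x\<in>I. r * x \<in> I)"

definition ideal_gen :: "'a::comm_ring_1 set \<Rightarrow> 'a set" where
  "ideal_gen S = \<Inter>{I. is_ideal I \<and> S \<subseteq> I}"

definition prime_ideal :: "'a::comm_ring_1 set \<Rightarrow> bool" where
  "prime_ideal P \<longleftrightarrow> is_ideal P \<and> P \<noteq> UNIV \<and> (\<forall>a b. a * b \<in> P \<longrightarrow> a \<in> P \<or> b \<in> P)"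

definition noetherian_ring :: "'a::comm_ring_1 itself \<Rightarrow> bool" where
  "noetherian_ring _ \<longleftrightarrow> (\<forall>I::'a set. is_ideal I \<longrightarrow> (\<exists>S. finite S \<and> I = ideal_gen S))"

definition nonzerodivisor :: "'a::comm_ring_1 \<Rightarrow> bool" where
  "nonzerodivisor s \<longleftrightarrow> (\<forall>x. s * x = 0 \<longrightarrow> x = 0)"

definition Vset :: "'a::comm_ring_1 set \<Rightarrow> 'a set set" where
  "Vset I = {P. prime_ideal P \<and> I \<subseteq> P}"

definition regular_seq :: "'a::comm_ring_1 list \<Rightarrow> bool" where
  "regular_seq xs \<longleftrightarrow> ideal_gen (set xs) \<noteq> UNIV \<and>
     (\<forall>i < length xs. \<forall>y. xs ! i * y \<in> ideal_gen (set (take i xs)) \<longrightarrow> y \<in> ideal_gen (set (take i xs)))"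

definition grade :: "'a::comm_ring_1 set \<Rightarrow> enat" where
  "grade I = (if I = UNIV then \<infinity>
     else Sup (enat ` {n. \<exists>xs. length xs = n \<and> set xs \<subseteq> I \<and> regular_seq xs}))"

section \<open>Submodules of the free module G = R^e, e = CARD('n)\<close>

definition vsmult :: "'a::comm_ring_1 \<Rightarrow> ('n \<Rightarrow> 'a) \<Rightarrow> ('n \<Rightarrow> 'a)" where
  "vsmult s g = (\<lambda>i. s * g i)"

definition submod :: "('n \<Rightarrow> 'a::comm_ring_1) set \<Rightarrow> bool" where
  "submod E \<longleftrightarrow> 0 \<in> E \<and> (\<forall>x\<in>E. \<forall>y\<in>E. x + y \<in> E) \<and> (\<forall>r. \<forall>x\<in>E. vsmult r x \<in> E)"

definition mspan :: "('n \<Rightarrow> 'a::comm_ring_1) set \<Rightarrow> ('n \<Rightarrow> 'a) set" where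
  "mspan S = \<Inter>{T. submod T \<and> S \<subseteq> T}"

definition fin_gen :: "('n \<Rightarrow> 'a::comm_ring_1) set \<Rightarrow> bool" where
  "fin_gen E \<longleftrightarrow> (\<exists>S. finite S \<and> E = mspan S)"

definition torsionfree :: "('n \<Rightarrow> 'a::comm_ring_1) set \<Rightarrow> bool" where
  "torsionfree E \<longleftrightarrow> (\<forall>x\<in>E. \<forall>s. nonzerodivisor s \<and> vsmult s x = 0 \<longrightarrow> x = 0)"

text \<open>For E \<subseteq> G = R^e: E \<otimes> Q = Q^e, i.e. the localization of E at the nonzerodivisors
  is all of G \<otimes> Q = Q^e (each element of G becomes an element of E after multiplying
  with a nonzerodivisor).\<close>
definition rank_full :: "('n \<Rightarrow> 'a::comm_ring_1) set \<Rightarrow> bool" where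
  "rank_full E \<longleftrightarrow> (\<forall>g. \<exists>s. nonzerodivisor s \<and> vsmult s g \<in> E)"

definition ann_quot :: "('n \<Rightarrow> 'a::comm_ring_1) set \<Rightarrow> 'a set" where
  "ann_quot E = {r. \<forall>g. vsmult r g \<in> E}"

definition grade_quot :: "('n \<Rightarrow> 'a::comm_ring_1) set \<Rightarrow> enat" where
  "grade_quot E = grade (ann_quot E)"

text \<open>Supp(G/E) = primes P with (G/E)_P \<noteq> 0.\<close>
definition Supp_quot :: "('n \<Rightarrow> 'a::comm_ring_1) set \<Rightarrow> 'a set set" where
  "Supp_quot E = {P. prime_ideal P \<and> (\<exists>g. \<forall>s. s \<notin> P \<longrightarrow> vsmult s g \<notin> E)}"

definition relations :: "('n \<Rightarrow> 'a::comm_ring_1) list \<Rightarrow> (nat \<Rightarrow> 'a) set" where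
  "relations vs = {a. (\<forall>j\<ge>length vs. a j = 0) \<and> (\<Sum>j<length vs. vsmult (a j) (vs ! j)) = 0}"

text \<open>i-th Fitting ideal w.r.t. generators vs: ideal generated by the (n-i)-minors of
  the presentation matrix (rows = relations, columns = generators).\<close>
definition fitting_wrt :: "nat \<Rightarrow> ('n \<Rightarrow> 'a::comm_ring_1) list \<Rightarrow> 'a set" where
  "fitting_wrt i vs = (let n = length vs; k = n - i in
     ideal_gen {det (mat k k (\<lambda>(p, q). (rs ! p) (cs ! q))) | rs cs.
        length rs = k \<and> set rs \<subseteq> relations vs \<and> length cs = k \<and> set cs \<subseteq> {0..<n}})"

definition Fitting :: "nat \<Rightarrow> ('n \<Rightarrow> 'a::comm_ring_1) set \<Rightarrow> 'a set" where
  "Fitting i E = fitting_wrt i (SOME vs. E = mspan (set vs))"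

type_synonym ('n, 'a) rpoly = "('n \<Rightarrow>\<^sub>0 nat) \<Rightarrow>\<^sub>0 'a"

definition linform :: "('n::finite \<Rightarrow> 'a::comm_ring_1) \<Rightarrow> ('n, 'a) rpoly" where
  "linform a = (\<Sum>i\<in>UNIV. Poly_Mapping.single (Poly_Mapping.single i 1) (a i))"

definition const_poly :: "'a::comm_ring_1 \<Rightarrow> ('n, 'a) rpoly" where
  "const_poly c = Poly_Mapping.single 0 c"

definition add_span :: "'b::comm_monoid_add set \<Rightarrow> 'b set" where
  "add_span S = {(\<Sum>i<m. f i) | (m::nat) f. \<forall>i<m. f i \<in> S}"

text \<open>E^n: degree-n component of R(E) \<subseteq> R[t_1..t_e].\<close>
definition rees_pow :: "('n::finite \<Rightarrow> 'a::comm_ring_1) set \<Rightarrow> nat \<Rightarrow> ('n, 'a) rpoly set" where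
  "rees_pow E n = add_span {const_poly c * prod_list (map linform vs) | c vs.
      length vs = n \<and> set vs \<subseteq> E}"

definition rees_mult :: "('n::finite \<Rightarrow> 'a::comm_ring_1) set \<Rightarrow> ('n, 'a) rpoly set \<Rightarrow> ('n, 'a) rpoly set" where
  "rees_mult U M = add_span {linform u * f | u f. u \<in> U \<and> f \<in> M}"

definition reduction :: "('n::finite \<Rightarrow> 'a::comm_ring_1) set \<Rightarrow> ('n \<Rightarrow> 'a) set \<Rightarrow> bool" where
  "reduction U E \<longleftrightarrow> submod U \<and> U \<subseteq> E \<and> (\<exists>r. rees_pow E (r + 1) = rees_mult U (rees_pow E r))"

end

theory Submission
  imports Defs
begin

text \<open>All assertions are read off the closed set \<open>V(ann (G/E)) = Supp (G/E)\<close>, since the grade of an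
  ideal depends only on its radical: powers of a regular sequence are again regular. If \<open>E\<close>
  agrees with \<open>G\<close> at a prime, then so does every reduction \<open>U\<close> of \<open>E\<close>, because a proper
  reduction of a free module would have linear forms with a common nontrivial zero over the
  residue field; hence \<open>Supp (G/U) = Supp (G/E)\<close>. Finally \<open>F_e(E)\<close> defines the locus where \<open>E\<close>
  needs more than \<open>e\<close> generators; elsewhere \<open>E\<close> is free of rank \<open>e\<close>, and a regular sequence of
  length two annihilating \<open>G/E\<close> then forces \<open>E = G\<close> locally.\<close>

section \<open>Ideals and primes\<close>

text \<open>No localization or quotient is formed. That \<open>E\<close> agrees with
  \<open>G\<close> at \<open>P\<close> means that some \<open>s\<close> outside \<open>P\<close>
  multiplies \<open>G\<close> into \<open>E\<close>, and linear algebra over the residue field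
  becomes congruences modulo \<open>P\<close> with a common denominator outside \<open>P\<close>.
  Such multipliers pile up as powers, which is harmless because \<open>P\<close> is prime. Depth two
  enters in the inclusion of V(ann(G/E)) in V(F_e(E)). The case \<open>e = 1\<close> with
  \<open>E\<close> generated by a nonunit nonzerodivisor shows the obstacle: \<open>E\<close> is
  free and its \<open>F_1\<close> is the unit ideal, yet \<open>G/E\<close> is nonzero. Local
  freeness itself comes from determinants: a multiplier of \<open>G\<close> into the span of
  \<open>e\<close> vectors makes these vectors independent up to a power of that multiplier. Since
  \<open>Fitting\<close> selects a generating list by choice, the comparison with ann(G/E) is made
  for every generating list.\<close>

lemma is_ideal_ideal_gen: "is_ideal (ideal_gen S)"
  unfolding ideal_gen_def is_ideal_def by auto

lemma subset_ideal_gen: "S \<subseteq> ideal_gen S"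
  unfolding ideal_gen_def by auto

lemma ideal_gen_minimal: "is_ideal I \<Longrightarrow> S \<subseteq> I \<Longrightarrow> ideal_gen S \<subseteq> I"
  unfolding ideal_gen_def by auto

lemma ideal_0: "is_ideal I \<Longrightarrow> 0 \<in> I"
  and ideal_add: "is_ideal I \<Longrightarrow> a \<in> I \<Longrightarrow> b \<in> I \<Longrightarrow> a + b \<in> I"
  and ideal_mult_left: "is_ideal I \<Longrightarrow> a \<in> I \<Longrightarrow> r * a \<in> I"
  unfolding is_ideal_def by auto

lemma ideal_mult_right: "is_ideal I \<Longrightarrow> a \<in> I \<Longrightarrow> a * r \<in> I"
  using ideal_mult_left[of I a r] by (simp add: mult.commute)

lemma ideal_uminus: "is_ideal I \<Longrightarrow> a \<in> I \<Longrightarrow> - a \<in> I"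
  using ideal_mult_left[of I a "- 1"] by simp

lemma ideal_diff: "is_ideal I \<Longrightarrow> a \<in> I \<Longrightarrow> b \<in> I \<Longrightarrow> a - b \<in> I"
  using ideal_add[of I a "- b"] ideal_uminus[of I b] by simp

lemma ideal_eq_UNIV: "is_ideal I \<Longrightarrow> 1 \<in> I \<Longrightarrow> I = UNIV"
  using ideal_mult_left[of I 1] by auto

lemma prime_ideal_is_ideal: "prime_ideal P \<Longrightarrow> is_ideal P"
  unfolding prime_ideal_def by simp

lemma prime_ideal_one: "prime_ideal P \<Longrightarrow> 1 \<notin> P"
  unfolding prime_ideal_def using ideal_eq_UNIV by blast

lemma prime_ideal_mult: "prime_ideal P \<Longrightarrow> a \<notin> P \<Longrightarrow> b \<notin> P \<Longrightarrow> a * b \<notin> P"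
  unfolding prime_ideal_def by blast

lemma prime_ideal_prod:
  "prime_ideal P \<Longrightarrow> (\<And>i. i \<in> A \<Longrightarrow> f i \<notin> P) \<Longrightarrow> prod f A \<notin> P"
  by (induction A rule: infinite_finite_induct)
    (auto simp: prime_ideal_one prime_ideal_mult)

lemma prime_ideal_power: "prime_ideal P \<Longrightarrow> a \<notin> P \<Longrightarrow> a ^ n \<notin> P"
  by (induction n) (auto simp: prime_ideal_one prime_ideal_mult)

text \<open>Plays the part of passing from \<open>R/I\<close> to \<open>R/(I + (x))\<close>; the
  explicit form lets an element be split at once.\<close>

definition adjoin :: "'a::comm_ring_1 set \<Rightarrow> 'a \<Rightarrow> 'a set" where
  "adjoin I x = {i + x * r | i r. i \<in> I}"

lemma adjoinI: "i \<in> I \<Longrightarrow> a = i + x * r \<Longrightarrow> a \<in> adjoin I x"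
  unfolding adjoin_def by auto

lemma is_ideal_adjoin:
  assumes "is_ideal I" shows "is_ideal (adjoin I x)"
  unfolding is_ideal_def
proof (intro conjI ballI allI)
  show "0 \<in> adjoin I x"
    by (rule adjoinI[OF ideal_0[OF assms], of _ _ 0]) simp
next
  fix a b assume "a \<in> adjoin I x" "b \<in> adjoin I x"
  then obtain i r j t where "a = i + x * r" "b = j + x * t" "i \<in> I" "j \<in> I"
    unfolding adjoin_def by auto
  moreover have "(i + x * r) + (j + x * t) = (i + j) + x * (r + t)" by (simp add: algebra_simps)
  ultimately show "a + b \<in> adjoin I x"
    by (intro adjoinI[OF ideal_add[OF assms], of i j _ _ "r + t"]) simp_all
next
  fix c a assume "a \<in> adjoin I x"
  then obtain i r where "a = i + x * r" "i \<in> I" unfolding adjoin_def by auto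
  moreover have "c * (i + x * r) = c * i + x * (c * r)" by (simp add: algebra_simps)
  ultimately show "c * a \<in> adjoin I x"
    by (intro adjoinI[OF ideal_mult_left[OF assms], of i _ c _ "c * r"]) simp_all
qed

lemma subset_adjoin: "I \<subseteq> adjoin I x"
  by (auto intro: adjoinI[of _ _ _ _ 0])

lemma mem_adjoin: "is_ideal I \<Longrightarrow> x * r \<in> adjoin I x"
  by (rule adjoinI[of 0]) (auto intro: ideal_0)

lemma adjoinE:
  assumes "a \<in> adjoin I x" obtains i r where "a = i + x * r" "i \<in> I"
  using assms unfolding adjoin_def by auto

lemma adjoin_minimal: "is_ideal J \<Longrightarrow> I \<subseteq> J \<Longrightarrow> x \<in> J \<Longrightarrow> adjoin I x \<subseteq> J"
  unfolding adjoin_def using ideal_add[of J] ideal_mult_right[of J] by auto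

lemma adjoin_commute: "adjoin (adjoin I x) y = adjoin (adjoin I y) x"
proof -
  have "adjoin (adjoin I x) y \<subseteq> adjoin (adjoin I y) x" for x y :: 'a
  proof
    fix a assume "a \<in> adjoin (adjoin I x) y"
    then obtain i r t where "a = (i + x * r) + y * t" "i \<in> I" unfolding adjoin_def by auto
    moreover have "(i + x * r) + y * t = (i + y * t) + x * r" by (simp add: algebra_simps)
    ultimately show "a \<in> adjoin (adjoin I y) x" by (auto intro!: adjoinI[OF adjoinI])
  qed
  then show ?thesis by blast
qed

lemma adjoin_ideal_gen: "adjoin (ideal_gen A) x = ideal_gen (insert x A)"
proof
  have A: "A \<subseteq> ideal_gen (insert x A)" and x: "x \<in> ideal_gen (insert x A)"
    using subset_ideal_gen[of "insert x A"] by auto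
  show "adjoin (ideal_gen A) x \<subseteq> ideal_gen (insert x A)"
    by (intro adjoin_minimal ideal_gen_minimal is_ideal_ideal_gen A x)
  have "x \<in> adjoin (ideal_gen A) x"
    using mem_adjoin[OF is_ideal_ideal_gen, of x 1 A] by simp
  moreover have "A \<subseteq> adjoin (ideal_gen A) x"
    by (rule order_trans[OF subset_ideal_gen subset_adjoin])
  ultimately show "ideal_gen (insert x A) \<subseteq> adjoin (ideal_gen A) x"
    by (intro ideal_gen_minimal is_ideal_adjoin is_ideal_ideal_gen) simp
qed

text \<open>By Zorn: an ideal maximal among those that contain \<open>I\<close> and miss all powers
  of \<open>x\<close> is prime. This converts inclusions between closed sets into memberships of
  powers.\<close>

lemma exists_prime_avoiding_powers:
  assumes I: "is_ideal I" and x: "\<And>n. x ^ n \<notin> I"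
  obtains P where "prime_ideal P" "I \<subseteq> P" "x \<notin> P"
proof -
  define \<A> where "\<A> = {J. is_ideal J \<and> I \<subseteq> J \<and> (\<forall>n. x ^ n \<notin> J)}"
  have "\<exists>M\<in>\<A>. \<forall>J\<in>\<A>. M \<subseteq> J \<longrightarrow> J = M"
  proof (rule subset_Zorn_nonempty)
    show "\<A> \<noteq> {}" using I x unfolding \<A>_def by auto
  next
    fix C assume ne: "C \<noteq> {}" and chain: "subset.chain \<A> C"
    have sub: "J \<in> \<A>" if "J \<in> C" for J using chain that unfolding subset_chain_def by auto
    have "is_ideal (\<Union>C)"
      unfolding is_ideal_def
    proof (intro conjI ballI allI)
      show "0 \<in> \<Union>C" using ne sub ideal_0 unfolding \<A>_def by blast
    next
      fix a b assume "a \<in> \<Union>C" "b \<in> \<Union>C"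
      then obtain J where "J \<in> C" "a \<in> J" "b \<in> J"
        using chain unfolding subset_chain_def by blast
      then show "a + b \<in> \<Union>C" using sub ideal_add unfolding \<A>_def by blast
    next
      fix r a assume "a \<in> \<Union>C"
      then show "r * a \<in> \<Union>C" using sub ideal_mult_left unfolding \<A>_def by blast
    qed
    then show "\<Union>C \<in> \<A>" using ne sub unfolding \<A>_def by blast
  qed
  then obtain M where M: "M \<in> \<A>" and max: "\<And>J. J \<in> \<A> \<Longrightarrow> M \<subseteq> J \<Longrightarrow> J = M" by blast
  have iM: "is_ideal M" and IM: "I \<subseteq> M" and xM: "\<And>n. x ^ n \<notin> M" using M unfolding \<A>_def by auto
  have power_in: "\<exists>n. x ^ n \<in> adjoin M a" if "a \<notin> M" for a
  proof (rule ccontr)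
    assume "\<not> ?thesis"
    then have "adjoin M a = M"
      using max subset_adjoin[of M a] is_ideal_adjoin[OF iM] IM unfolding \<A>_def by blast
    then show False using mem_adjoin[OF iM, of a 1] that by simp
  qed
  have "a \<in> M \<or> b \<in> M" if ab: "a * b \<in> M" for a b
  proof (rule ccontr)
    assume "\<not> ?thesis"
    then obtain m n where "x ^ m \<in> adjoin M a" "x ^ n \<in> adjoin M b" using power_in by blast
    then obtain i r j t where eq: "x ^ m = i + a * r" "x ^ n = j + b * t" and ij: "i \<in> M" "j \<in> M"
      by (auto elim!: adjoinE)
    \<comment> \<open>Each summand has a factor in \<open>M\<close>: \<open>i\<close>,
      \<open>j\<close> or \<open>a * b\<close>.\<close>
    have "x ^ (m + n) = i * x ^ n + (j * (a * r) + (a * b) * (r * t))"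
      unfolding power_add eq by (simp add: algebra_simps)
    also have "\<dots> \<in> M" by (intro ideal_add ideal_mult_right iM ij ab)
    finally show False using xM by blast
  qed
  then have "prime_ideal M" unfolding prime_ideal_def using iM xM[of 0] by auto
  then show thesis using that IM xM[of 1] by simp
qed

lemma power_mem_of_Vset_subset:
  assumes "is_ideal I" "Vset I \<subseteq> Vset J" "x \<in> J"
  shows "\<exists>n. x ^ n \<in> I"
  using exists_prime_avoiding_powers[of I x] assms unfolding Vset_def by blast

section \<open>Regular sequences\<close>

text \<open>Weak regularity on \<open>R/I\<close>. Properness is split off in
  \<open>regular_seq_iff_reg_mod\<close>, so that inductions may change \<open>I\<close>
  freely.\<close>

primrec reg_mod :: "'a::comm_ring_1 set \<Rightarrow> 'a list \<Rightarrow> bool" where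
  "reg_mod I [] = True"
| "reg_mod I (x # xs) = ((\<forall>y. x * y \<in> I \<longrightarrow> y \<in> I) \<and> reg_mod (adjoin I x) xs)"

lemma reg_mod_ideal_gen:
  "reg_mod (ideal_gen A) xs \<longleftrightarrow>
    (\<forall>i < length xs. \<forall>y. xs ! i * y \<in> ideal_gen (A \<union> set (take i xs)) \<longrightarrow>
      y \<in> ideal_gen (A \<union> set (take i xs)))"
proof (induction xs arbitrary: A)
  case (Cons x xs)
  show ?case
    unfolding reg_mod.simps adjoin_ideal_gen Cons.IH length_Cons All_less_Suc2 by simp
qed simp

lemma regular_seq_iff_reg_mod:
  "regular_seq xs \<longleftrightarrow> ideal_gen (set xs) \<noteq> UNIV \<and> reg_mod (ideal_gen {}) xs"
  unfolding regular_seq_def reg_mod_ideal_gen by simp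

text \<open>This is additivity along \<open>0 \<rightarrow> R/(I : x) \<rightarrow> R/I \<rightarrow> R/(I + x) \<rightarrow> 0\<close>.\<close>

lemma reg_mod_extension:
  assumes "is_ideal I" "reg_mod {r. x * r \<in> I} ys" "reg_mod (adjoin I x) ys"
  shows "reg_mod I ys"
  using assms
proof (induction ys arbitrary: I)
  case (Cons y ys)
  note I = Cons.prems(1)
  have colon: "\<And>r. x * (y * r) \<in> I \<Longrightarrow> x * r \<in> I"
    and sum: "\<And>r. y * r \<in> adjoin I x \<Longrightarrow> r \<in> adjoin I x"
    using Cons.prems(2,3) unfolding reg_mod.simps by blast+
  have "z \<in> I" if z: "y * z \<in> I" for z
  proof -
    obtain i r where zi: "z = i + x * r" "i \<in> I"
      using sum[of z] z subset_adjoin[of I x] by (auto elim!: adjoinE)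
    have "x * (y * r) = y * z - y * i" unfolding zi by (simp add: algebra_simps)
    also have "\<dots> \<in> I" by (intro ideal_diff ideal_mult_left I z zi)
    finally show ?thesis using colon zi ideal_add[OF I] by simp
  qed
  \<comment> \<open>The exact sequence stays exact modulo \<open>y\<close> because \<open>y\<close>
    is regular on its right-hand term, so forming the colon by \<open>x\<close> commutes with
    adjoining \<open>y\<close> and the induction can go on.\<close>
  moreover have "{r. x * r \<in> adjoin I y} = adjoin {r. x * r \<in> I} y"
  proof (intro equalityI subsetI)
    fix r assume "r \<in> {r. x * r \<in> adjoin I y}"
    then obtain i s where s: "x * r = i + y * s" "i \<in> I" by (auto elim: adjoinE)
    have "y * s = - i + x * r" using s by simp
    then have "y * s \<in> adjoin I x" by (rule adjoinI[OF ideal_uminus[OF I s(2)]])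
    then obtain j t where t: "s = j + x * t" "j \<in> I" using sum[of s] by (auto elim!: adjoinE)
    have "x * (r - y * t) = i + y * j" using s t by (simp add: algebra_simps)
    also have "\<dots> \<in> I" by (intro ideal_add ideal_mult_left I s t)
    finally have "r - y * t \<in> {r. x * r \<in> I}" by simp
    then show "r \<in> adjoin {r. x * r \<in> I} y" by (rule adjoinI[of _ _ _ _ t]) simp
  next
    fix r assume "r \<in> adjoin {r. x * r \<in> I} y"
    then obtain i t where r: "r = i + y * t" "x * i \<in> I" by (auto elim: adjoinE)
    have "x * r = x * i + y * (x * t)" using r by (simp add: algebra_simps)
    then show "r \<in> {r. x * r \<in> adjoin I y}" using adjoinI[OF r(2)] by blast
  qed
  then have "reg_mod (adjoin I y) ys"
    using Cons.IH[OF is_ideal_adjoin[OF I], of y] Cons.prems(2,3)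
    unfolding reg_mod.simps adjoin_commute[of I x y] by argo
  ultimately show ?case unfolding reg_mod.simps by blast
qed simp

text \<open>As \<open>x\<close> is regular modulo \<open>I\<close>, multiplication by
  \<open>x\<close> gives an exact sequence
  \<open>0 -> R/(I + x^(n+1)) -> R/(I + x^(n+2)) -> R/(I + x) -> 0\<close>, and
  \<open>reg_mod_extension\<close> raises the exponent by one.\<close>

lemma reg_mod_adjoin_power:
  assumes I: "is_ideal I" and x: "\<And>y. x * y \<in> I \<Longrightarrow> y \<in> I" and ys: "reg_mod (adjoin I x) ys"
  shows "reg_mod (adjoin I (x ^ Suc n)) ys"
proof (induction n)
  case (Suc n)
  let ?J = "adjoin I (x ^ Suc (Suc n))"
  have "{r. x * r \<in> ?J} = adjoin I (x ^ Suc n)"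
  proof (intro equalityI subsetI)
    fix r assume "r \<in> {r. x * r \<in> ?J}"
    then obtain i t where i: "x * r = i + x ^ Suc (Suc n) * t" "i \<in> I" by (auto elim: adjoinE)
    have "x * (r - x ^ Suc n * t) = i" using i by (simp add: algebra_simps)
    then have "r - x ^ Suc n * t \<in> I" using x i by simp
    then show "r \<in> adjoin I (x ^ Suc n)" by (rule adjoinI[of _ _ _ _ t]) simp
  next
    fix r assume "r \<in> adjoin I (x ^ Suc n)"
    then obtain i t where i: "r = i + x ^ Suc n * t" "i \<in> I" by (auto elim: adjoinE)
    have "x * r = x * i + x ^ Suc (Suc n) * t" using i by (simp add: algebra_simps)
    then show "r \<in> {r. x * r \<in> ?J}" using adjoinI[OF ideal_mult_left[OF I i(2)]] by blast
  qed
  moreover have "adjoin ?J x = adjoin I x"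
  proof
    have iJ: "is_ideal (adjoin ?J x)" "is_ideal (adjoin I x)" by (intro is_ideal_adjoin I)+
    have "x * x ^ Suc n \<in> adjoin I x" "x * 1 \<in> adjoin I x" by (intro mem_adjoin I)+
    then show "adjoin ?J x \<subseteq> adjoin I x"
      by (intro adjoin_minimal iJ subset_adjoin) simp_all
    have "x * 1 \<in> adjoin ?J x" by (intro mem_adjoin is_ideal_adjoin I)
    then show "adjoin I x \<subseteq> adjoin ?J x"
      by (intro adjoin_minimal iJ order_trans[OF subset_adjoin subset_adjoin]) simp
  qed
  ultimately show ?case
    using reg_mod_extension[OF is_ideal_adjoin[OF I], of x] Suc.IH ys by simp
qed (use ys in simp)

text \<open>The exponent varies with the entry because membership in a radical provides a separate
  power for each element.\<close>

lemma reg_mod_powers: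
  "is_ideal I \<Longrightarrow> reg_mod I xs \<Longrightarrow> reg_mod I (map (\<lambda>x. x ^ Suc (f x)) xs)"
proof (induction xs arbitrary: I)
  case (Cons x xs)
  have x: "\<And>y. x * y \<in> I \<Longrightarrow> y \<in> I"
    and xs: "reg_mod (adjoin I x) xs" using Cons.prems(2) unfolding reg_mod.simps by blast+
  have "y \<in> I" if "x ^ n * y \<in> I" for n y
    using that by (induction n) (auto simp: mult.assoc dest: x)
  moreover have "reg_mod (adjoin I (x ^ Suc (f x))) (map (\<lambda>x. x ^ Suc (f x)) xs)"
    by (intro Cons.IH is_ideal_adjoin reg_mod_adjoin_power Cons.prems(1) xs) (rule x)
  ultimately show ?case unfolding list.map reg_mod.simps by blast
qed simp

text \<open>Every element of \<open>J\<close> has a power in \<open>I\<close>; replacing the entries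
  of a regular sequence in \<open>J\<close> by such powers moves it into \<open>I\<close> without
  changing its length.\<close>

lemma grade_mono_Vset:
  assumes I: "is_ideal I" and J: "is_ideal J" and V: "Vset I \<subseteq> Vset J"
  shows "grade J \<le> grade I"
proof (cases "I = UNIV")
  case False
  have "J \<noteq> UNIV"
  proof
    assume "J = UNIV"
    then obtain n where "1 ^ n \<in> I" using power_mem_of_Vset_subset[OF I V, of 1] by auto
    then show False using ideal_eq_UNIV[OF I] False by simp
  qed
  have "\<exists>f. \<forall>x\<in>J. x ^ f x \<in> I"
    using power_mem_of_Vset_subset[OF I V] by (intro bchoice ballI)
  then obtain f where "\<And>x. x \<in> J \<Longrightarrow> x ^ f x \<in> I" by blast
  \<comment> \<open>One more factor makes the exponent visibly positive, as
    \<open>reg_mod_powers\<close> requires.\<close>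
  then have f: "x ^ Suc (f x) \<in> I" if "x \<in> J" for x
    using that ideal_mult_left[OF I] by simp
  have "\<exists>ys. length ys = length xs \<and> set ys \<subseteq> I \<and> regular_seq ys"
    if xs: "set xs \<subseteq> J" "regular_seq xs" for xs
  proof (intro exI[of _ "map (\<lambda>x. x ^ Suc (f x)) xs"] conjI)
    let ?ys = "map (\<lambda>x. x ^ Suc (f x)) xs"
    show sub: "set ?ys \<subseteq> I" using f xs by (auto simp del: power_Suc)
    then have "ideal_gen (set ?ys) \<noteq> UNIV" using ideal_gen_minimal[OF I sub] False by auto
    then show "regular_seq ?ys"
      using xs reg_mod_powers[OF is_ideal_ideal_gen] unfolding regular_seq_iff_reg_mod by blast
  qed simp
  then have "{n. \<exists>xs. length xs = n \<and> set xs \<subseteq> J \<and> regular_seq xs} \<subseteq>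
      {n. \<exists>xs. length xs = n \<and> set xs \<subseteq> I \<and> regular_seq xs}" by fastforce
  then show ?thesis
    unfolding grade_def using False \<open>J \<noteq> UNIV\<close> by (simp add: Sup_subset_mono image_mono)
qed (simp add: grade_def)

lemma grade_eq_of_Vset_eq:
  "is_ideal I \<Longrightarrow> is_ideal J \<Longrightarrow> Vset I = Vset J \<Longrightarrow> grade I = grade J"
  by (simp add: grade_mono_Vset antisym)

text \<open>Some regular sequence in \<open>I\<close> has length at least two, since otherwise the
  supremum would be at most 1; its first two entries serve. \<open>I \<noteq> UNIV\<close> excludes
  the case where the grade is infinite by convention.\<close>

lemma grade_ge_2E:
  assumes "2 \<le> grade I" "I \<noteq> UNIV"
  obtains x y where "x \<in> I" "y \<in> I" "\<And>z. x * z = 0 \<Longrightarrow> z = 0"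
    "\<And>z w. y * z = x * w \<Longrightarrow> \<exists>t. z = x * t"
proof -
  let ?N = "{n. \<exists>xs. length xs = n \<and> set xs \<subseteq> I \<and> regular_seq xs}"
  have "\<exists>n\<in>?N. 2 \<le> n"
  proof (rule ccontr)
    assume "\<not> ?thesis"
    then have "Sup (enat ` ?N) \<le> 1" by (intro Sup_least) (force simp: one_enat_def)
    moreover have "grade I = Sup (enat ` ?N)" using assms(2) unfolding grade_def by simp
    ultimately have "(2::enat) \<le> 1" using assms(1) by (metis (no_types) order_trans)
    then show False by (simp add: numeral_eq_enat one_enat_def)
  qed
  then obtain xs where xs: "2 \<le> length xs" "set xs \<subseteq> I" "regular_seq xs" by auto
  then obtain x y zs where eq: "xs = x # y # zs"
    by (cases xs; cases "tl xs") auto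
  have gen_empty: "ideal_gen {} = {0::'a}"
    using ideal_gen_minimal[of "{0::'a}" "{}"] ideal_0[OF is_ideal_ideal_gen]
    by (auto simp: is_ideal_def)
  then have reg: "\<And>z. x * z = 0 \<Longrightarrow> z = 0"
      "\<And>z. y * z \<in> adjoin {0} x \<Longrightarrow> z \<in> adjoin {0} x"
    using xs(3) unfolding regular_seq_iff_reg_mod eq reg_mod.simps gen_empty singleton_iff by blast+
  have "\<exists>t. z = x * t" if "y * z = x * w" for z w
    using that reg(2)[of z] unfolding adjoin_def by auto
  then show thesis using that[of x y] reg(1) xs(2) unfolding eq by force
qed

section \<open>Submodules of a free module\<close>

lemma submod_mspan: "submod (mspan S)"
  unfolding mspan_def submod_def by auto

lemma subset_mspan: "S \<subseteq> mspan S"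
  unfolding mspan_def by auto

lemma mspan_minimal: "submod T \<Longrightarrow> S \<subseteq> T \<Longrightarrow> mspan S \<subseteq> T"
  unfolding mspan_def by auto

lemma mspan_mono: "S \<subseteq> T \<Longrightarrow> mspan S \<subseteq> mspan T"
  by (intro mspan_minimal submod_mspan order_trans[OF _ subset_mspan])

lemma submod_0: "submod U \<Longrightarrow> 0 \<in> U"
  and submod_add: "submod U \<Longrightarrow> a \<in> U \<Longrightarrow> b \<in> U \<Longrightarrow> a + b \<in> U"
  and submod_vsmult: "submod U \<Longrightarrow> a \<in> U \<Longrightarrow> vsmult r a \<in> U"
  unfolding submod_def by auto

lemma submod_uminus: "submod U \<Longrightarrow> a \<in> U \<Longrightarrow> - a \<in> U"
  using submod_vsmult[of U a "- 1"] by (simp add: vsmult_def fun_Compl_def)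

lemma submod_diff: "submod U \<Longrightarrow> a \<in> U \<Longrightarrow> b \<in> U \<Longrightarrow> a - b \<in> U"
  using submod_add[of U a "- b"] submod_uminus[of U b] by simp

lemma submod_sum: "submod U \<Longrightarrow> (\<And>i. i \<in> A \<Longrightarrow> f i \<in> U) \<Longrightarrow> sum f A \<in> U"
  by (induction A rule: infinite_finite_induct) (auto intro: submod_0 submod_add)

lemma vsmult_apply [simp]: "vsmult r g i = r * g i"
  by (simp add: vsmult_def)

lemma vsmult_vsmult: "vsmult r (vsmult s g) = vsmult (r * s) g"
  by (simp add: vsmult_def mult.assoc)

lemma sum_fun_apply: "sum f A x = (\<Sum>a\<in>A. f a x)" for f :: "'b \<Rightarrow> 'n \<Rightarrow> 'a::comm_ring_1"
  by (induction A rule: infinite_finite_induct) auto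

lemma mspan_image_eq:
  assumes "finite B"
  shows "mspan (v ` B) = {\<Sum>b\<in>B. vsmult (c b) (v b) | c. True}"
proof
  let ?T = "{\<Sum>b\<in>B. vsmult (c b) (v b) | c. True}"
  have "submod ?T"
    unfolding submod_def
  proof (intro conjI ballI allI)
    show "0 \<in> ?T"
      by (auto intro!: exI[of _ "\<lambda>_. 0"] simp: fun_eq_iff sum_fun_apply)
  next
    fix x y assume "x \<in> ?T" "y \<in> ?T"
    then obtain c d where "x = (\<Sum>b\<in>B. vsmult (c b) (v b))" "y = (\<Sum>b\<in>B. vsmult (d b) (v b))" by blast
    then have "x + y = (\<Sum>b\<in>B. vsmult (c b + d b) (v b))"
      by (simp add: fun_eq_iff sum_fun_apply sum.distrib distrib_right)
    then show "x + y \<in> ?T" by auto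
  next
    fix r x assume "x \<in> ?T"
    then obtain c where "x = (\<Sum>b\<in>B. vsmult (c b) (v b))" by blast
    then have "vsmult r x = (\<Sum>b\<in>B. vsmult (r * c b) (v b))"
      by (simp add: fun_eq_iff sum_fun_apply sum_distrib_left mult.assoc)
    then show "vsmult r x \<in> ?T" by auto
  qed
  moreover have "v a \<in> ?T" if "a \<in> B" for a
  proof -
    have "v a = (\<Sum>b\<in>B. vsmult (if b = a then 1 else 0) (v b))"
      using that assms by (simp add: fun_eq_iff sum_fun_apply if_distrib[of "\<lambda>x. x * _"] cong: if_cong)
    then show ?thesis by auto
  qed
  ultimately show "mspan (v ` B) \<subseteq> ?T" by (intro mspan_minimal) auto
  show "?T \<subseteq> mspan (v ` B)"
    using subset_mspan[of "v ` B"] by (auto intro!: submod_sum submod_vsmult submod_mspan)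
qed

lemma mspan_imageE:
  assumes "finite B" "u \<in> mspan (v ` B)"
  obtains c where "u = (\<Sum>b\<in>B. vsmult (c b) (v b))"
  using assms unfolding mspan_image_eq[OF assms(1)] by auto

text \<open>Gaussian elimination over the residue field of \<open>P\<close>, with denominators cleared.\<close>

lemma functional_or_span:
  fixes v :: "'i \<Rightarrow> 'n \<Rightarrow> 'a::comm_ring_1"
  assumes P: "prime_ideal P" and "finite S"
  shows "(\<exists>l. (\<exists>i\<in>S. l i \<notin> P) \<and> (\<forall>j\<in>I. (\<Sum>i\<in>S. l i * v j i) \<in> P)) \<or>
    (\<exists>B s. B \<subseteq> I \<and> finite B \<and> card B \<le> card S \<and> s \<notin> P \<and>
      (\<forall>i\<in>S. \<exists>u\<in>mspan (v ` B). \<forall>j\<in>S. u j = (if j = i then s else 0)))"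
  using assms(2)
proof (induction S rule: finite_induct)
  case empty
  show ?case using prime_ideal_one[OF P] by (intro disjI2 exI[of _ "{}"] exI[of _ 1]) auto
next
  case (insert k S)
  note iP = prime_ideal_is_ideal[OF P]
  from insert.IH show ?case
  proof (elim disjE exE conjE)
    fix l assume l: "\<exists>i\<in>S. l i \<notin> P" "\<forall>j\<in>I. (\<Sum>i\<in>S. l i * v j i) \<in> P"
    define m where "m = l(k := 0)"
    have "(\<Sum>i\<in>insert k S. m i * v j i) = (\<Sum>i\<in>S. l i * v j i)" for j
      using insert.hyps unfolding m_def by (auto intro: sum.cong)
    moreover have "\<exists>i\<in>insert k S. m i \<notin> P"
      using l(1) insert.hyps unfolding m_def by (metis fun_upd_other insertCI)
    ultimately show ?case using l(2) by (intro disjI1 exI[of _ m] conjI) simp_all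
  next
    fix B s
    assume B: "B \<subseteq> I" "finite B" "card B \<le> card S" and s: "s \<notin> P"
      and "\<forall>i\<in>S. \<exists>u\<in>mspan (v ` B). \<forall>j\<in>S. u j = (if j = i then s else 0)"
    then obtain u where u: "\<And>i. i \<in> S \<Longrightarrow> u i \<in> mspan (v ` B)"
        "\<And>i j. i \<in> S \<Longrightarrow> j \<in> S \<Longrightarrow> u i j = (if j = i then s else 0)"
      by metis
    \<comment> \<open>Old pivots clear the coordinates in \<open>S\<close>, so among the coordinates
      \<open>insert k S\<close> only \<open>k\<close> can survive in \<open>w j\<close>.\<close>
    define w where "w j = vsmult s (v j) - (\<Sum>i\<in>S. vsmult (v j i) (u i))" for j
    have wS: "w j i = 0" if "i \<in> S" for i j
    proof -
      have "(\<Sum>i'\<in>S. v j i' * u i' i) = (\<Sum>i'\<in>S. if i = i' then v j i' * s else 0)"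
        using u(2) that by (intro sum.cong) auto
      then show ?thesis
        using that insert.hyps unfolding w_def by (simp add: sum_fun_apply mult.commute)
    qed
    have wk: "w j k = s * v j k - (\<Sum>i\<in>S. u i k * v j i)" for j
      unfolding w_def by (simp add: sum_fun_apply mult.commute)
    show ?case
    proof (cases "\<forall>j\<in>I. w j k \<in> P")
      case True
      \<comment> \<open>The functional that reads off \<open>w j k\<close> from \<open>v j\<close>;
        its coefficient at \<open>k\<close> is \<open>s\<close>, hence nonzero modulo
        \<open>P\<close>.\<close>
      define l where "l i = (if i = k then s else - u i k)" for i
      have "(\<Sum>i\<in>insert k S. l i * v j i) = w j k" for j
      proof -
        have "(\<Sum>i\<in>S. l i * v j i) = (\<Sum>i\<in>S. - (u i k * v j i))"
          using insert.hyps unfolding l_def by (intro sum.cong) auto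
        then show ?thesis using insert.hyps unfolding wk by (simp add: l_def sum_negf)
      qed
      then show ?thesis using True s by (intro disjI1 exI[of _ l]) (auto simp: l_def)
    next
      case False
      then obtain j where j: "j \<in> I" "w j k \<notin> P" by blast
      let ?B = "insert j B"
      have uB: "u i \<in> mspan (v ` ?B)" if "i \<in> S" for i
        using u(1)[OF that] mspan_mono[of "v ` B" "v ` ?B"] by blast
      have "v j \<in> mspan (v ` ?B)" using subset_mspan[of "v ` ?B"] by simp
      then have wB: "w j \<in> mspan (v ` ?B)"
        unfolding w_def by (intro submod_diff submod_sum submod_vsmult submod_mspan uB)
      \<comment> \<open>New pivot times old denominator. It is the least convenient common scale:
        \<open>s\<close> times \<open>w j\<close> gives the unit vector at \<open>k\<close>, and
        cross-multiplying \<open>u i\<close> with \<open>w j\<close> clears coordinate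
        \<open>k\<close> of \<open>u i\<close>.\<close>
      define t where "t = w j k * s"
      have "\<exists>x\<in>mspan (v ` ?B). \<forall>i'\<in>insert k S. x i' = (if i' = i then t else 0)"
        if "i \<in> insert k S" for i
      proof (cases "i = k")
        case True
        show ?thesis
          using insert.hyps wS True
          by (intro bexI[of _ "vsmult s (w j)"] submod_vsmult submod_mspan wB)
            (auto simp: t_def mult.commute)
      next
        case False
        then have i: "i \<in> S" using that by simp
        show ?thesis
          using insert.hyps wS u(2)[OF i] i False
          by (intro bexI[of _ "vsmult (w j k) (u i) - vsmult (u i k) (w j)"]
              submod_diff submod_vsmult submod_mspan wB uB)
            (auto simp: t_def mult.commute)
      qed
      moreover have "t \<notin> P" unfolding t_def by (intro prime_ideal_mult P j s)
      moreover have "card ?B \<le> card (insert k S)"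
        using B insert.hyps by (simp add: card_insert_if)
      ultimately show ?thesis
        using B j by (intro disjI2 exI[of _ ?B] exI[of _ t] conjI ballI) simp_all
    qed
  qed
qed

text \<open>Stands in for Nakayama's lemma at \<open>P\<close>: vectors that span modulo
  \<open>P\<close> span \<open>G\<close> locally, and at most \<open>e\<close> of them suffice. Both
  applications refute the functional and exploit the span.\<close>

lemma functional_or_span_UNIV:
  fixes v :: "'i \<Rightarrow> 'n::finite \<Rightarrow> 'a::comm_ring_1"
  assumes P: "prime_ideal P"
  obtains l k where "l k \<notin> P" "\<And>j. j \<in> I \<Longrightarrow> (\<Sum>i\<in>UNIV. l i * v j i) \<in> P"
  | B s where "B \<subseteq> I" "finite B" "card B \<le> card (UNIV :: 'n set)" "s \<notin> P" "\<And>g. vsmult s g \<in> mspan (v ` B)"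
proof -
  consider l k where "l k \<notin> P" "\<forall>j\<in>I. (\<Sum>i\<in>UNIV. l i * v j i) \<in> P"
    | B s where "B \<subseteq> I" "finite B" "card B \<le> card (UNIV :: 'n set)" "s \<notin> P"
      "\<forall>i. \<exists>u\<in>mspan (v ` B). \<forall>j. u j = (if j = i then s else 0)"
    using functional_or_span[OF P finite_UNIV, where I = I and v = v] by auto
  then show thesis
  proof cases
    case 1
    then show thesis using that(1) by blast
  next
    case (2 B s)
    then obtain u where u: "\<And>i. u i \<in> mspan (v ` B)" "\<And>i j. u i j = (if j = i then s else 0)"
      by metis
    have "vsmult s g = (\<Sum>i\<in>UNIV. vsmult (g i) (u i))" for g
      by (simp add: fun_eq_iff sum_fun_apply u(2) if_distrib[of "\<lambda>x. _ * x"] mult.commute cong: if_cong)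
    then have "vsmult s g \<in> mspan (v ` B)" for g
      by (auto intro!: submod_sum submod_vsmult submod_mspan u(1))
    then show thesis using that(2) 2 by blast
  qed
qed

text \<open>\<open>G\<close> is generated by finitely many unit vectors, so the product of one
  multiplier for each works for all of \<open>G\<close> and still avoids \<open>P\<close>.\<close>

lemma Supp_quot_eq_Vset_ann_quot:
  fixes E :: "('n::finite \<Rightarrow> 'a::comm_ring_1) set"
  assumes E: "submod E"
  shows "Supp_quot E = Vset (ann_quot E)"
proof -
  have "\<exists>r\<in>ann_quot E. r \<notin> P" if P: "prime_ideal P" and all: "\<And>g. \<exists>s. s \<notin> P \<and> vsmult s g \<in> E" for P
  proof -
    let ?e = "\<lambda>i j. if j = i then 1 else 0"
    obtain s where s: "\<And>i. s i \<notin> P" "\<And>i. vsmult (s i) (?e i) \<in> E"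
      using all[of "?e _"] by metis
    have "vsmult (\<Prod>i\<in>UNIV. s i) g \<in> E" for g
    proof -
      have "vsmult (\<Prod>i\<in>UNIV. s i) g =
          (\<Sum>i\<in>UNIV. vsmult ((\<Prod>j\<in>UNIV - {i}. s j) * g i) (vsmult (s i) (?e i)))"
        using prod.remove[OF finite_UNIV UNIV_I, of s]
        by (simp add: fun_eq_iff sum_fun_apply if_distrib[of "\<lambda>x. _ * x"] mult_ac cong: if_cong)
      also have "\<dots> \<in> E" by (intro submod_sum submod_vsmult E s)
      finally show ?thesis .
    qed
    then show ?thesis
      using prime_ideal_prod[OF P, of UNIV s] s(1) unfolding ann_quot_def by blast
  qed
  then show ?thesis unfolding Supp_quot_def Vset_def ann_quot_def by blast
qed

lemma is_ideal_ann_quot: "submod E \<Longrightarrow> is_ideal (ann_quot E)"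
proof -
  assume E: "submod E"
  have "vsmult 0 g = 0" "vsmult (x + y) g = vsmult x g + vsmult y g" for x y :: 'b and g :: "'a \<Rightarrow> 'b"
    by (simp_all add: fun_eq_iff distrib_right)
  then show ?thesis
    using submod_0[OF E] submod_add[OF E] submod_vsmult[OF E]
    unfolding is_ideal_def ann_quot_def by (simp flip: vsmult_vsmult)
qed

lemma is_ideal_coordinates:
  assumes U: "submod U" shows "is_ideal ((\<lambda>u. u k) ` U)"
  unfolding is_ideal_def
proof (intro conjI ballI allI)
  show "0 \<in> (\<lambda>u. u k) ` U" by (rule image_eqI[OF _ submod_0[OF U]]) simp
next
  fix x y assume "x \<in> (\<lambda>u. u k) ` U" "y \<in> (\<lambda>u. u k) ` U"
  then obtain a b where "x = a k" "y = b k" "a \<in> U" "b \<in> U" by blast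
  then show "x + y \<in> (\<lambda>u. u k) ` U" by (intro image_eqI[OF _ submod_add[OF U, of a b]]) auto
next
  fix r x assume "x \<in> (\<lambda>u. u k) ` U"
  then obtain a where "x = a k" "a \<in> U" by blast
  then show "r * x \<in> (\<lambda>u. u k) ` U" by (intro image_eqI[OF _ submod_vsmult[OF U, of a r]]) auto
qed

text \<open>Induction on the number of coordinates on which the elements of \<open>U\<close> may be nonzero.\<close>

lemma fin_gen_submod:
  fixes U :: "('n::finite \<Rightarrow> 'a::comm_ring_1) set"
  assumes noeth: "noetherian_ring TYPE('a)" and "submod U"
  shows "fin_gen U"
proof -
  have "fin_gen U" if "finite S" "submod U" "\<forall>u\<in>U. \<forall>i. i \<notin> S \<longrightarrow> u i = 0" for S and U :: "('n \<Rightarrow> 'a) set"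
    using that
  proof (induction S arbitrary: U rule: finite_induct)
    case empty
    then have "U = {0}" using submod_0 by (auto simp: fun_eq_iff)
    moreover have "mspan {} \<subseteq> ({0} :: ('n \<Rightarrow> 'a) set)"
      by (intro mspan_minimal) (auto simp: submod_def fun_eq_iff)
    ultimately have "U = mspan {}" using submod_0[OF submod_mspan] by blast
    then show ?case unfolding fin_gen_def by blast
  next
    case (insert k S)
    note U = insert.prems(1)
    have "is_ideal ((\<lambda>u. u k) ` U)" by (rule is_ideal_coordinates[OF U])
    then obtain X where X: "finite X" "(\<lambda>u. u k) ` U = ideal_gen X"
      using noeth unfolding noetherian_ring_def by blast
    then have "X \<subseteq> (\<lambda>u. u k) ` U" using subset_ideal_gen[of X] by simp
    then obtain T where T: "finite T" "T \<subseteq> U" "X = (\<lambda>u. u k) ` T"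
      using X(1) finite_subset_image by metis
    \<comment> \<open>Kernel of the \<open>k\<close>-th coordinate on \<open>U\<close>. Its
      generators, together with lifts \<open>T\<close> of generators of the image ideal, generate
      \<open>U\<close>.\<close>
    define U' where "U' = {u \<in> U. u k = 0}"
    have "submod U'" using U unfolding submod_def U'_def by simp
    moreover have "\<forall>u\<in>U'. \<forall>i. i \<notin> S \<longrightarrow> u i = 0"
      using insert.prems(2) unfolding U'_def by auto
    ultimately obtain T' where T': "finite T'" "U' = mspan T'"
      using insert.IH unfolding fin_gen_def by blast
    have "U \<subseteq> mspan (T \<union> T')"
    proof
      fix u assume u: "u \<in> U"
      have "ideal_gen X \<subseteq> (\<lambda>u. u k) ` mspan T"
        unfolding T(3) using subset_mspan[of T]
        by (intro ideal_gen_minimal is_ideal_coordinates submod_mspan) auto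
      then have "u k \<in> (\<lambda>u. u k) ` mspan T" using u X(2) by auto
      then obtain w where w: "w \<in> mspan T" "w k = u k" by auto
      have "w \<in> U" using w(1) mspan_minimal[OF U T(2)] by blast
      then have "u - w \<in> mspan T'" using submod_diff[OF U u] w(2) T'(2) unfolding U'_def by auto
      then have "(u - w) + w \<in> mspan (T \<union> T')"
        using w(1) mspan_mono[of T "T \<union> T'"] mspan_mono[of T' "T \<union> T'"]
        by (intro submod_add submod_mspan) auto
      then show "u \<in> mspan (T \<union> T')" by simp
    qed
    moreover have "T' \<subseteq> U" using T'(2) subset_mspan[of T'] unfolding U'_def by blast
    then have "mspan (T \<union> T') \<subseteq> U" using T by (intro mspan_minimal U) auto
    ultimately have "U = mspan (T \<union> T')" by blast
    then show ?case unfolding fin_gen_def using T(1) T'(1) by blast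
  qed
  from this[of UNIV] show ?thesis using assms(2) by simp
qed

section \<open>Reductions\<close>

text \<open>Substitution of \<open>l i\<close> for the variable \<open>t_i\<close>. Being
  multiplicative, it lets the reduction equation be tested at a point.\<close>

definition eval_poly :: "('n::finite \<Rightarrow> 'a::comm_ring_1) \<Rightarrow> ('n, 'a) rpoly \<Rightarrow> 'a" where
  "eval_poly l p = (\<Sum>m\<in>Poly_Mapping.keys p. Poly_Mapping.lookup p m * (\<Prod>i\<in>UNIV. l i ^ Poly_Mapping.lookup m i))"

lemma eval_poly_single: "eval_poly l (Poly_Mapping.single m c) = c * (\<Prod>i\<in>UNIV. l i ^ Poly_Mapping.lookup m i)"
  by (simp add: eval_poly_def)

lemma eval_poly_add: "eval_poly l (p + q) = eval_poly l p + eval_poly l q"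
  unfolding eval_poly_def by (rule setsum_keys_plus_distrib) (simp_all add: distrib_right)

lemma eval_poly_sum: "eval_poly l (sum f A) = (\<Sum>a\<in>A. eval_poly l (f a))"
  by (induction A rule: infinite_finite_induct) (simp_all add: eval_poly_add, simp_all add: eval_poly_def)

lemma sum_singles: "p = (\<Sum>m\<in>Poly_Mapping.keys p. Poly_Mapping.single m (Poly_Mapping.lookup p m))"
  by (rule poly_mapping_eqI) (simp add: lookup_sum lookup_single when_def in_keys_iff)

lemma eval_poly_mult: "eval_poly l (p * q) = eval_poly l p * eval_poly l q"
proof -
  have "p * q = (\<Sum>m\<in>Poly_Mapping.keys p. \<Sum>n\<in>Poly_Mapping.keys q.
      Poly_Mapping.single (m + n) (Poly_Mapping.lookup p m * Poly_Mapping.lookup q n))"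
    by (subst sum_singles[of p], subst sum_singles[of q])
      (simp add: sum_product mult_single)
  then show ?thesis
    by (simp add: eval_poly_sum eval_poly_single lookup_add power_add prod.distrib)
      (simp add: eval_poly_def sum_product mult_ac)
qed

lemma eval_poly_const: "eval_poly l (const_poly c) = c"
  by (simp add: const_poly_def eval_poly_single)

lemma eval_poly_linform: "eval_poly l (linform a) = (\<Sum>i\<in>UNIV. l i * a i)"
proof -
  have "(\<Prod>j\<in>UNIV. l j ^ Poly_Mapping.lookup (Poly_Mapping.single i 1) j) = l i" for i
  proof -
    have "(\<Prod>j\<in>UNIV. l j ^ Poly_Mapping.lookup (Poly_Mapping.single i (1::nat)) j) = (\<Prod>j\<in>UNIV. if j = i then l i else 1)"
      by (rule prod.cong) (auto simp: lookup_single when_def)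
    then show ?thesis by simp
  qed
  then show ?thesis
    by (simp add: linform_def eval_poly_sum eval_poly_single mult.commute)
qed

lemma subset_add_span: "S \<subseteq> add_span S"
proof
  fix x assume "x \<in> S"
  then show "x \<in> add_span S"
    unfolding add_span_def by (intro CollectI exI[of _ 1] exI[of _ "\<lambda>_. x"]) simp
qed

lemma add_span_minimal:
  assumes "S \<subseteq> T" "0 \<in> T" "\<And>x y. x \<in> T \<Longrightarrow> y \<in> T \<Longrightarrow> x + y \<in> T"
  shows "add_span S \<subseteq> T"
proof -
  have "(\<Sum>i<m. f i) \<in> T" if "\<forall>i<m. f i \<in> S" for m :: nat and f
    using that by (induction m) (use assms in auto)
  then show ?thesis unfolding add_span_def by auto
qed

lemma const_poly_mem_rees_pow_0: "const_poly c \<in> rees_pow E 0"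
  unfolding rees_pow_def by (rule subsetD[OF subset_add_span]) (auto intro: exI[of _ c])

lemma rees_pow_0: "rees_pow E 0 = range const_poly"
proof
  show "rees_pow E 0 \<subseteq> range const_poly"
    unfolding rees_pow_def
  proof (rule add_span_minimal)
    show "0 \<in> range const_poly" by (rule range_eqI[of _ _ 0]) (simp add: const_poly_def)
  next
    fix x y :: "('a, 'b) rpoly" assume "x \<in> range const_poly" "y \<in> range const_poly"
    then obtain a b where "x = const_poly a" "y = const_poly b" by blast
    then show "x + y \<in> range const_poly"
      by (intro range_eqI[of _ _ "a + b"]) (simp add: const_poly_def single_add)
  qed auto
qed (auto intro: const_poly_mem_rees_pow_0)

text \<open>\<open>r = 0\<close> suffices. Having \<open>E\<close> among its own reductions links
  (a) to (b) and (c).\<close>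

lemma reduction_refl:
  assumes "submod E" shows "reduction E E"
proof -
  have "{const_poly c * prod_list (map linform vs) | c vs. length vs = 1 \<and> set vs \<subseteq> E} =
      {linform u * f | u f. u \<in> E \<and> f \<in> rees_pow E 0}" (is "?A = ?B")
  proof (intro equalityI subsetI)
    fix x assume "x \<in> ?A"
    then obtain c vs where x: "x = const_poly c * prod_list (map linform vs)"
      "length vs = 1" "set vs \<subseteq> E" by blast
    then obtain u where "vs = [u]" by (auto simp: length_Suc_conv)
    then have "x = linform u * const_poly c" "u \<in> E" using x by (simp_all add: mult.commute)
    then show "x \<in> ?B" unfolding rees_pow_0 by blast
  next
    fix x assume "x \<in> ?B"
    then obtain u c where "x = linform u * const_poly c" "u \<in> E" unfolding rees_pow_0 by blast
    then show "x \<in> ?A" by (intro CollectI exI[of _ c] exI[of _ "[u]"]) (simp add: mult.commute)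
  qed
  then have "rees_pow E (0 + 1) = rees_mult E (rees_pow E 0)"
    unfolding rees_pow_def[of E "0 + 1"] rees_mult_def by simp
  then show ?thesis using assms unfolding reduction_def by blast
qed

text \<open>Locally at \<open>P\<close> the module \<open>E\<close> is all of \<open>G\<close>, so \<open>U\<close> is a reduction of a free module; if it
  were proper, its linear forms would have a common zero \<open>l\<close> over the residue field, and
  evaluating \<open>E\<^sup>r\<^sup>+\<^sup>1 = U E\<^sup>r\<close> at \<open>l\<close> would give a contradiction.\<close>

lemma reduction_local:
  fixes E :: "('n::finite \<Rightarrow> 'a::comm_ring_1) set"
  assumes red: "reduction U E" and P: "prime_ideal P" and s: "s \<notin> P" "s \<in> ann_quot E"
  obtains t where "t \<notin> P" "t \<in> ann_quot U"
proof -
  note iP = prime_ideal_is_ideal[OF P]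
  have U: "submod U" using red unfolding reduction_def by blast
  obtain r where r: "rees_pow E (r + 1) = rees_mult U (rees_pow E r)"
    using red unfolding reduction_def by blast
  show thesis
  proof (rule functional_or_span_UNIV[OF P, where I = U and v = "\<lambda>u. u"])
    fix l k assume lk: "l k \<notin> P" and l: "\<And>u. u \<in> U \<Longrightarrow> (\<Sum>i\<in>UNIV. l i * u i) \<in> P"
    \<comment> \<open>A multiple of the unit vector at a coordinate where \<open>l\<close> is
      nonzero modulo \<open>P\<close>; it lies in \<open>E\<close> because \<open>s\<close>
      annihilates \<open>G/E\<close>.\<close>
    define x where "x = vsmult s (\<lambda>i. if i = k then 1 else 0)"
    have xE: "x \<in> E" using s(2) unfolding ann_quot_def x_def by blast
    have "rees_mult U (rees_pow E r) \<subseteq> {f. eval_poly l f \<in> P}"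
      unfolding rees_mult_def
    proof (rule add_span_minimal)
      show "{linform u * f |u f. u \<in> U \<and> f \<in> rees_pow E r} \<subseteq> {f. eval_poly l f \<in> P}"
        using l ideal_mult_right[OF iP] by (auto simp: eval_poly_mult eval_poly_linform)
      show "0 \<in> {f. eval_poly l f \<in> P}" using ideal_0[OF iP] by (simp add: eval_poly_def)
    qed (simp add: eval_poly_add ideal_add[OF iP])
    \<comment> \<open>The contradiction comes from the power \<open>r + 1\<close> of the linear form
      of \<open>x\<close>: it lies in \<open>U E^r\<close>, whose elements all take values in
      \<open>P\<close> at \<open>l\<close>, yet its own value is
      \<open>(l k * s) ^ (r + 1)\<close>.\<close>
    moreover have "const_poly 1 * prod_list (map linform (replicate (r + 1) x)) \<in> rees_pow E (r + 1)"
      unfolding rees_pow_def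
      by (rule subsetD[OF subset_add_span], intro CollectI exI[of _ 1] exI[of _ "replicate (r + 1) x"])
        (simp add: xE set_replicate_conv_if)
    ultimately have "eval_poly l (const_poly 1 * prod_list (map linform (replicate (r + 1) x))) \<in> P"
      unfolding r by blast
    moreover have "eval_poly l (const_poly 1 * prod_list (map linform (replicate (r + 1) x))) =
        (l k * s) ^ (r + 1)"
    proof -
      have "eval_poly l (linform x) = l k * s"
        by (simp add: eval_poly_linform x_def if_distrib[of "\<lambda>x. _ * x"] cong: if_cong)
      then have "eval_poly l (linform x ^ n) = (l k * s) ^ n" for n
        by (induction n) (simp_all add: eval_poly_mult eval_poly_const[of l 1, unfolded const_poly_def single_one])
      then show ?thesis
        by (simp add: eval_poly_mult eval_poly_const del: power_Suc replicate_Suc)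
    qed
    ultimately show thesis
      using prime_ideal_power[OF P prime_ideal_mult[OF P lk s(1)]] by metis
  next
    fix B t assume B: "B \<subseteq> U" "t \<notin> P" "\<And>g. vsmult t g \<in> mspan ((\<lambda>u. u) ` B)"
    then have "t \<in> ann_quot U" using mspan_minimal[OF U B(1)] unfolding ann_quot_def by auto
    then show thesis using that B by blast
  qed
qed

lemma Vset_ann_quot_reduction:
  fixes E :: "('n::finite \<Rightarrow> 'a::comm_ring_1) set"
  assumes "reduction U E"
  shows "Vset (ann_quot U) = Vset (ann_quot E)"
proof
  have "ann_quot U \<subseteq> ann_quot E" using assms unfolding ann_quot_def reduction_def by blast
  then show "Vset (ann_quot E) \<subseteq> Vset (ann_quot U)" unfolding Vset_def by blast
  show "Vset (ann_quot U) \<subseteq> Vset (ann_quot E)"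
    using reduction_local[OF assms] unfolding Vset_def by blast
qed

section \<open>Fitting ideals\<close>

lemma vsmult_mem_mspan:
  assumes "\<And>x. x \<in> S \<Longrightarrow> vsmult d x \<in> mspan T" "u \<in> mspan S"
  shows "vsmult d u \<in> mspan T"
proof -
  have "vsmult d 0 = 0" "vsmult d (a + b) = vsmult d a + vsmult d b"
    "vsmult d (vsmult r a) = vsmult r (vsmult d a)" for a b :: "'a \<Rightarrow> 'b" and r
    by (simp_all add: fun_eq_iff algebra_simps)
  then have "submod {u. vsmult d u \<in> mspan T}"
    using submod_0[OF submod_mspan, of T] submod_add[OF submod_mspan, of _ T]
      submod_vsmult[OF submod_mspan, of _ T]
    unfolding submod_def by simp
  then show ?thesis using mspan_minimal[of "{u. vsmult d u \<in> mspan T}" S] assms by blast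
qed

text \<open>Locally at \<open>P\<close> at most \<open>e\<close> of the \<open>n\<close> generators
  span \<open>G\<close>. Each of the others satisfies a relation with leading coefficient
  \<open>t\<close>, and \<open>n - e\<close> such relations give a minor that is a power of
  \<open>t\<close>.\<close>

lemma Fitting_not_subset_prime:
  fixes vs :: "('n::finite \<Rightarrow> 'a::comm_ring_1) list"
  assumes P: "prime_ideal P" and s: "s \<notin> P" "s \<in> ann_quot (mspan (set vs))"
  shows "\<not> fitting_wrt (card (UNIV :: 'n set)) vs \<subseteq> P"
proof -
  note iP = prime_ideal_is_ideal[OF P]
  let ?n = "length vs" and ?e = "card (UNIV :: 'n set)"
  define k where "k = ?n - ?e"
  show ?thesis
  proof (rule functional_or_span_UNIV[OF P, where I = "{..<?n}" and v = "\<lambda>j. vs ! j"])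
    fix l i0 assume l0: "l i0 \<notin> P" and l: "\<And>j. j \<in> {..<?n} \<Longrightarrow> (\<Sum>i\<in>UNIV. l i * (vs ! j) i) \<in> P"
    have "submod {u. (\<Sum>i\<in>UNIV. l i * u i) \<in> P}"
      unfolding submod_def
      using ideal_0[OF iP] ideal_add[OF iP] ideal_mult_left[OF iP]
      by (simp add: distrib_left sum.distrib mult.left_commute flip: sum_distrib_left)
    moreover have "set vs \<subseteq> {u. (\<Sum>i\<in>UNIV. l i * u i) \<in> P}"
      using l by (auto simp: in_set_conv_nth)
    ultimately have "mspan (set vs) \<subseteq> {u. (\<Sum>i\<in>UNIV. l i * u i) \<in> P}" by (rule mspan_minimal)
    moreover have "vsmult s (\<lambda>i. if i = i0 then 1 else 0) \<in> mspan (set vs)"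
      using s(2) unfolding ann_quot_def by blast
    ultimately have "(\<Sum>i\<in>UNIV. l i * vsmult s (\<lambda>i. if i = i0 then 1 else 0) i) \<in> P" by blast
    then have "l i0 * s \<in> P" by (simp add: if_distrib[of "\<lambda>x. _ * x"] cong: if_cong)
    then show ?thesis using prime_ideal_mult[OF P l0 s(1)] by blast
  next
    fix B t assume B: "B \<subseteq> {..<?n}" "finite B" "card B \<le> ?e" and t: "t \<notin> P"
      and tB: "\<And>g. vsmult t g \<in> mspan ((!) vs ` B)"
    \<comment> \<open>If \<open>n \<le> e\<close>, truncated subtraction gives \<open>k = 0\<close>,
      and the minor below is the empty determinant 1.\<close>
    have "k \<le> card ({..<?n} - B)"
      unfolding k_def using B by (simp add: card_Diff_subset)
    then obtain C where C: "C \<subseteq> {..<?n} - B" "card C = k" "finite C"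
      using obtain_subset_with_card_n by metis
    define cs where "cs = sorted_list_of_set C"
    have cs: "set cs = C" "distinct cs" "length cs = k" unfolding cs_def using C by auto
    have "\<exists>c. vsmult t (vs ! j) = (\<Sum>b\<in>B. vsmult (c b) (vs ! b))" for j
      using mspan_imageE[OF B(2) tB] by blast
    then obtain c where c: "\<And>j. vsmult t (vs ! j) = (\<Sum>b\<in>B. vsmult (c j b) (vs ! b))" by metis
    \<comment> \<open>The relation expressing \<open>t\<close> times generator \<open>j\<close>
      through those in \<open>B\<close>. It vanishes in the other columns of \<open>C\<close>, so
      the minor is diagonal.\<close>
    define r where "r j i = (if i = j then t else if i \<in> B then - c j i else 0)" for j i
    have r: "r j \<in> relations vs" if j: "j \<in> C" for j
    proof -
      have jn: "j < ?n" "j \<notin> B" using j C(1) by auto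
      have "(\<Sum>i<?n. vsmult (r j i) (vs ! i)) =
          vsmult (r j j) (vs ! j) + (\<Sum>i\<in>{..<?n} - {j}. vsmult (r j i) (vs ! i))"
        by (rule sum.remove) (use jn in auto)
      also have "(\<Sum>i\<in>{..<?n} - {j}. vsmult (r j i) (vs ! i)) = (\<Sum>i\<in>B. vsmult (r j i) (vs ! i))"
        using B jn by (intro sum.mono_neutral_right) (auto simp: r_def fun_eq_iff)
      also have "\<dots> = (\<Sum>i\<in>B. - vsmult (c j i) (vs ! i))"
        using jn by (intro sum.cong) (auto simp: r_def fun_eq_iff)
      also have "\<dots> = - vsmult t (vs ! j)" by (simp add: sum_negf c)
      also have "vsmult (r j j) (vs ! j) + - vsmult t (vs ! j) = 0" unfolding r_def by simp
      finally have "(\<Sum>i<?n. vsmult (r j i) (vs ! i)) = 0" .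
      then show ?thesis using jn B(1) unfolding relations_def by (auto simp: r_def)
    qed
    let ?A = "mat k k (\<lambda>(p, q). (map r cs ! p) (cs ! q))"
    have "?A = t \<cdot>\<^sub>m 1\<^sub>m k"
    proof (rule eq_matI)
      fix p q assume "p < dim_row (t \<cdot>\<^sub>m 1\<^sub>m k)" "q < dim_col (t \<cdot>\<^sub>m 1\<^sub>m k)"
      then have pq: "p < k" "q < k" by auto
      then have "cs ! q \<in> C" using cs nth_mem by metis
      then have "cs ! q \<notin> B" using C(1) by blast
      moreover have "cs ! q = cs ! p \<longleftrightarrow> q = p" using cs pq nth_eq_iff_index_eq by metis
      ultimately show "?A $$ (p, q) = (t \<cdot>\<^sub>m 1\<^sub>m k) $$ (p, q)"
        using pq cs(3) by (simp add: r_def)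
    qed auto
    then have "det ?A = t ^ k" by simp
    moreover have "det ?A \<in> fitting_wrt ?e vs"
      unfolding fitting_wrt_def Let_def k_def[symmetric]
      using cs r C(1)
      by (intro subsetD[OF subset_ideal_gen] CollectI exI[of _ "map r cs"] exI[of _ cs]) auto
    ultimately show ?thesis using prime_ideal_power[OF P t, of k] by auto
  qed
qed

text \<open>By Cramer's rule, a nonvanishing maximal minor lets one eliminate the generators in its columns.\<close>

lemma minor_elimination:
  fixes vs :: "('n \<Rightarrow> 'a::comm_ring_1) list"
  assumes rs: "length rs = k" "set rs \<subseteq> relations vs"
    and cs: "length cs = k" "set cs \<subseteq> {0..<length vs}"
    and d: "d = det (mat k k (\<lambda>(p, q). (rs ! p) (cs ! q)))" "d \<noteq> 0"
  shows "card ({..<length vs} - set cs) = length vs - k"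
    and "u \<in> mspan (set vs) \<Longrightarrow> vsmult d u \<in> mspan ((!) vs ` ({..<length vs} - set cs))"
proof -
  let ?n = "length vs"
  define A where "A = mat k k (\<lambda>(p, q). (rs ! p) (cs ! q))"
  have A: "A \<in> carrier_mat k k" and dA: "det A = d" unfolding A_def d by auto
  \<comment> \<open>The definition of \<open>fitting_wrt\<close> allows repeated columns; a nonzero
    determinant rules them out, which makes the count of remaining generators exact.\<close>
  have "cs ! p \<noteq> cs ! q" if "p < k" "q < k" "p \<noteq> q" for p q
  proof
    assume "cs ! p = cs ! q"
    then have "col A p = col A q" using that unfolding A_def by (intro eq_vecI) auto
    then have "det A = 0" using det_identical_columns[OF A that(3,1,2)] by blast
    then show False using dA d(2) by simp
  qed
  then have dist: "distinct cs" unfolding distinct_conv_nth cs(1) by blast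
  define J where "J = {..<?n} - set cs"
  show "card ({..<?n} - set cs) = ?n - k"
    using cs distinct_card[OF dist] by (simp add: card_Diff_subset atLeast0LessThan)
  have J: "vs ! j \<in> mspan ((!) vs ` J)" if "j \<in> J" for j
    using that subset_mspan[of "(!) vs ` J"] by blast
  \<comment> \<open>Modulo the span of the generators in \<open>J\<close>, the relations become
    linear equations in the generators at \<open>cs\<close>, with matrix \<open>A\<close>.\<close>
  have row: "(\<Sum>q<k. vsmult (A $$ (p, q)) (vs ! (cs ! q))) \<in> mspan ((!) vs ` J)" if p: "p < k" for p
  proof -
    have "rs ! p \<in> relations vs" using p rs nth_mem by blast
    then have "0 = (\<Sum>j<?n. vsmult ((rs ! p) j) (vs ! j))" unfolding relations_def by simp
    also have "\<dots> = (\<Sum>j\<in>J. vsmult ((rs ! p) j) (vs ! j)) + (\<Sum>j\<in>set cs. vsmult ((rs ! p) j) (vs ! j))"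
      unfolding J_def by (rule sum.subset_diff) (use cs in auto)
    also have "(\<Sum>j\<in>set cs. vsmult ((rs ! p) j) (vs ! j)) = (\<Sum>q<k. vsmult ((rs ! p) (cs ! q)) (vs ! (cs ! q)))"
      using bij_betw_nth[OF dist, of "{..<k}" "set cs"] cs(1)
      by (intro sum.reindex_bij_betw[symmetric]) simp
    also have "\<dots> = (\<Sum>q<k. vsmult (A $$ (p, q)) (vs ! (cs ! q)))"
      using p unfolding A_def by (intro sum.cong) auto
    finally have "(\<Sum>q<k. vsmult (A $$ (p, q)) (vs ! (cs ! q))) = - (\<Sum>j\<in>J. vsmult ((rs ! p) j) (vs ! j))"
      by (rule minus_unique[OF sym, symmetric])
    then show ?thesis
      by (simp only:) (intro submod_uminus submod_sum submod_vsmult submod_mspan J)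
  qed
  have col: "vsmult d (vs ! (cs ! q)) \<in> mspan ((!) vs ` J)" if q: "q < k" for q
  proof -
    \<comment> \<open>Combining these equations with the \<open>q\<close>-th row of the adjugate
      isolates \<open>d\<close> times a single generator.\<close>
    let ?N = "adj_mat A"
    have N: "?N \<in> carrier_mat k k" "?N * A = d \<cdot>\<^sub>m 1\<^sub>m k" using adj_mat[OF A] dA by auto
    have entry: "(\<Sum>p<k. ?N $$ (q, p) * A $$ (p, q')) = (if q' = q then d else 0)" if "q' < k" for q'
    proof -
      have "(?N * A) $$ (q, q') = (\<Sum>p<k. ?N $$ (q, p) * A $$ (p, q'))"
        using q that A N(1) by (simp add: scalar_prod_def atLeast0LessThan)
      then show ?thesis using q that unfolding N(2) by auto
    qed
    have "(\<Sum>p<k. vsmult (?N $$ (q, p)) (\<Sum>q'<k. vsmult (A $$ (p, q')) (vs ! (cs ! q')))) =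
        (\<Sum>q'<k. vsmult (\<Sum>p<k. ?N $$ (q, p) * A $$ (p, q')) (vs ! (cs ! q')))"
      by (simp add: fun_eq_iff sum_fun_apply sum_distrib_left sum_distrib_right mult.assoc)
        (subst sum.swap, simp)
    also have "\<dots> = (\<Sum>q'<k. vsmult (if q' = q then d else 0) (vs ! (cs ! q')))"
      using entry by (intro sum.cong) auto
    also have "\<dots> = vsmult d (vs ! (cs ! q))"
      using q by (simp add: fun_eq_iff sum_fun_apply if_distrib[of "\<lambda>x. x * _"] cong: if_cong)
    finally have eq: "vsmult d (vs ! (cs ! q)) =
      (\<Sum>p<k. vsmult (?N $$ (q, p)) (\<Sum>q'<k. vsmult (A $$ (p, q')) (vs ! (cs ! q'))))" by simp
    show ?thesis
      unfolding eq by (intro submod_sum submod_vsmult submod_mspan row) simp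
  qed
  have "vsmult d x \<in> mspan ((!) vs ` J)" if x: "x \<in> set vs" for x
  proof -
    obtain j where j: "j < ?n" "x = vs ! j" using x unfolding in_set_conv_nth by blast
    show ?thesis
    proof (cases "j \<in> J")
      case True
      then show ?thesis unfolding j by (intro submod_vsmult submod_mspan J)
    next
      case False
      then have "j \<in> set cs" using j(1) unfolding J_def by simp
      then obtain q where q: "q < k" "j = cs ! q" unfolding in_set_conv_nth cs(1) by blast
      show ?thesis unfolding j(2) q(2) by (rule col[OF q(1)])
    qed
  qed
  then show "u \<in> mspan (set vs) \<Longrightarrow> vsmult d u \<in> mspan ((!) vs ` ({..<?n} - set cs))"
    unfolding J_def[symmetric] by (rule vsmult_mem_mspan)
qed

text \<open>Padding with zero vectors to exactly \<open>e\<close> of them makes the coordinate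
  matrix in \<open>torsion_of_relation\<close> square.\<close>

lemma mspan_image_lessThan:
  assumes "finite J" "card J \<le> e"
  obtains f :: "nat \<Rightarrow> 'n \<Rightarrow> 'a::comm_ring_1" where "mspan (f ` {..<e}) = mspan (w ` J)"
proof -
  obtain h where "bij_betw h {..<card J} J"
    using assms(1) ex_bij_betw_nat_finite[of J] by (auto simp: atLeast0LessThan)
  then have h: "h ` {..<card J} = J" by (simp add: bij_betw_def)
  define f where "f p = (if p < card J then w (h p) else 0)" for p
  have hJ: "h p \<in> J" if "p < card J" for p using h that by blast
  have "w ` h ` {..<card J} = f ` {..<card J}"
    unfolding image_image by (intro image_cong) (auto simp: f_def)
  then have "w ` J = f ` {..<card J}" unfolding h .
  also have "\<dots> \<subseteq> f ` {..<e}" using assms(2) by auto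
  finally have sub: "w ` J \<subseteq> f ` {..<e}" .
  have "f p \<in> mspan (w ` J)" for p
  proof (cases "p < card J")
    case True
    then have "w (h p) \<in> w ` J" by (intro imageI hJ)
    then show ?thesis using True subset_mspan[of "w ` J"] by (auto simp: f_def)
  qed (simp add: f_def submod_0[OF submod_mspan])
  then have "mspan (f ` {..<e}) \<subseteq> mspan (w ` J)" by (intro mspan_minimal submod_mspan) auto
  then show thesis using that mspan_mono[OF sub] by blast
qed

text \<open>Let \<open>W\<close> hold the coordinates of \<open>f\<close>, and let \<open>A\<close>
  express \<open>t\<close> times the unit vectors through \<open>f\<close>. Then
  \<open>A * W\<close> is \<open>t\<close> times the identity, so \<open>t ^ e\<close> is a multiple
  of \<open>det W\<close>, while the adjugate of \<open>W\<close> turns \<open>z W = 0\<close> into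
  \<open>z p * det W = 0\<close>.\<close>

lemma torsion_of_relation:
  fixes f :: "nat \<Rightarrow> 'n::finite \<Rightarrow> 'a::comm_ring_1"
  defines "e \<equiv> card (UNIV :: 'n set)"
  assumes t: "\<And>g. vsmult t g \<in> mspan (f ` {..<e})"
    and z: "(\<Sum>p<e. vsmult (z p) (f p)) = 0" and p: "p < e"
  shows "t ^ e * z p = 0"
proof -
  obtain h where "bij_betw h {0..<e} (UNIV :: 'n set)"
    using ex_bij_betw_nat_finite[of "UNIV :: 'n set"] unfolding e_def by auto
  then have h: "\<And>i j. i < e \<Longrightarrow> j < e \<Longrightarrow> h i = h j \<longleftrightarrow> i = j"
    unfolding bij_betw_def inj_on_def by auto
  have "\<forall>i. \<exists>c. vsmult t (\<lambda>j. if j = h i then 1 else 0) = (\<Sum>p<e. vsmult (c p) (f p))"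
    using mspan_imageE[OF finite_lessThan t] by blast
  from choice[OF this] obtain a
    where a: "\<And>i. vsmult t (\<lambda>j. if j = h i then 1 else 0) = (\<Sum>p<e. vsmult (a i p) (f p))" by blast
  define A where "A = mat e e (\<lambda>(i, p). a i p)"
  define W where "W = mat e e (\<lambda>(p, i). f p (h i))"
  have A: "A \<in> carrier_mat e e" and W: "W \<in> carrier_mat e e" unfolding A_def W_def by auto
  have "A * W = t \<cdot>\<^sub>m 1\<^sub>m e"
  proof (rule eq_matI)
    fix i j assume "i < dim_row (t \<cdot>\<^sub>m 1\<^sub>m e)" "j < dim_col (t \<cdot>\<^sub>m 1\<^sub>m e)"
    then have ij: "i < e" "j < e" by auto
    have "(A * W) $$ (i, j) = (\<Sum>p<e. a i p * f p (h j))"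
      using ij unfolding A_def W_def by (simp add: scalar_prod_def atLeast0LessThan)
    also have "\<dots> = t * (if h j = h i then 1 else 0)"
      using fun_cong[OF a[of i], of "h j"] by (simp add: sum_fun_apply)
    also have "\<dots> = (t \<cdot>\<^sub>m 1\<^sub>m e) $$ (i, j)" using ij h by auto
    finally show "(A * W) $$ (i, j) = (t \<cdot>\<^sub>m 1\<^sub>m e) $$ (i, j)" .
  qed (use A W in auto)
  then have det: "t ^ e = det A * det W" using det_mult[OF A W] by simp
  let ?N = "adj_mat W"
  have N: "?N \<in> carrier_mat e e" "W * ?N = det W \<cdot>\<^sub>m 1\<^sub>m e" using adj_mat[OF W] by auto
  have entry: "(\<Sum>i<e. W $$ (q, i) * ?N $$ (i, p)) = (if q = p then det W else 0)" if "q < e" for q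
  proof -
    have "(W * ?N) $$ (q, p) = (\<Sum>i<e. W $$ (q, i) * ?N $$ (i, p))"
      using p that W N(1) by (simp add: scalar_prod_def atLeast0LessThan)
    then show ?thesis using p that unfolding N(2) by auto
  qed
  have zW: "(\<Sum>q<e. z q * W $$ (q, i)) = 0" if "i < e" for i
    using fun_cong[OF z, of "h i"] that unfolding W_def by (simp add: sum_fun_apply)
  have "0 = (\<Sum>i<e. (\<Sum>q<e. z q * W $$ (q, i)) * ?N $$ (i, p))" using zW by simp
  also have "\<dots> = (\<Sum>q<e. z q * (\<Sum>i<e. W $$ (q, i) * ?N $$ (i, p)))"
    by (simp add: sum_distrib_left sum_distrib_right mult.assoc) (rule sum.swap)
  also have "\<dots> = (\<Sum>q<e. z q * (if q = p then det W else 0))"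
    using entry by (intro sum.cong) auto
  also have "\<dots> = z p * det W"
    using p by (simp add: if_distrib[of "\<lambda>x. _ * x"] cong: if_cong)
  finally show ?thesis unfolding det by (simp add: mult_ac)
qed

text \<open>The depth argument: where \<open>E\<close> is free of rank \<open>e\<close>, a regular sequence of length two on
  \<open>R\<close> is one on \<open>E\<close>, so an element of \<open>G\<close> that \<open>x\<close> and \<open>y\<close> multiply into \<open>E\<close> lies in \<open>E\<close>.\<close>

lemma power_mem_ann_quot:
  fixes E :: "('n::finite \<Rightarrow> 'a::comm_ring_1) set"
  defines "e \<equiv> card (UNIV :: 'n set)"
  assumes ann: "x \<in> ann_quot E" "y \<in> ann_quot E"
    and x: "\<And>z. x * z = 0 \<Longrightarrow> z = 0" and y: "\<And>z w. y * z = x * w \<Longrightarrow> \<exists>t. z = x * t"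
    and J: "finite J" "card J \<le> e" and sub: "mspan (w ` J) \<subseteq> E"
    and d: "\<And>u. u \<in> E \<Longrightarrow> vsmult d u \<in> mspan (w ` J)"
  shows "d ^ Suc e \<in> ann_quot E"
proof -
  obtain f where f: "mspan (f ` {..<e}) = mspan (w ` J)"
    using mspan_image_lessThan[OF J] by blast
  have xpow: "z = 0" if "x ^ n * z = 0" for n z
    using that by (induction n) (use x in \<open>auto simp: mult.assoc\<close>)
  have xg: "vsmult (d * x) g \<in> mspan (f ` {..<e})" and yg: "vsmult (d * y) g \<in> mspan (f ` {..<e})" for g
    using ann d unfolding ann_quot_def f by (auto simp flip: vsmult_vsmult)
  have "vsmult (d ^ Suc e) g \<in> E" for g
  proof -
    obtain a where a: "vsmult (d * x) g = (\<Sum>p<e. vsmult (a p) (f p))"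
      using mspan_imageE[OF _ xg] by blast
    obtain b where b: "vsmult (d * y) g = (\<Sum>p<e. vsmult (b p) (f p))"
      using mspan_imageE[OF _ yg] by blast
    \<comment> \<open>Both terms on the right are \<open>d * x * y\<close> times \<open>g\<close>,
      so the two expansions differ by a relation among the \<open>f p\<close>.\<close>
    have "(\<Sum>p<e. vsmult (y * a p - x * b p) (f p)) = vsmult y (vsmult (d * x) g) - vsmult x (vsmult (d * y) g)"
      unfolding a b
      by (simp add: fun_eq_iff sum_fun_apply sum_distrib_left left_diff_distrib sum_subtractf mult.assoc)
    also have "\<dots> = 0" by (simp add: fun_eq_iff mult_ac)
    finally have rel: "(\<Sum>p<e. vsmult (y * a p - x * b p) (f p)) = 0" .
    have "\<exists>c. d ^ e * a p = x * c" if "p < e" for p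
    proof -
      \<comment> \<open>The multiplier here is \<open>d * x\<close>. Its factor \<open>x ^ e\<close>
        cancels, but \<open>d ^ e\<close> must stay since \<open>d\<close> may be a
        zerodivisor.\<close>
      have "(d * x) ^ e * (y * a p - x * b p) = 0"
        by (rule torsion_of_relation[where f = f, folded e_def, OF xg rel that])
      then have "d ^ e * (y * a p - x * b p) = 0"
        using xpow[of e] by (simp add: power_mult_distrib mult_ac)
      then have "y * (d ^ e * a p) = x * (d ^ e * b p)" by (simp add: algebra_simps)
      then show ?thesis by (rule y)
    qed
    then obtain c where c: "\<And>p. p < e \<Longrightarrow> d ^ e * a p = x * c p" by metis
    \<comment> \<open>Explains \<open>Suc e\<close>: one factor \<open>d\<close> moves
      \<open>E\<close> into the span, and \<open>e\<close> more make the coefficients divisible by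
      \<open>x\<close>, which then cancels in each coordinate.\<close>
    have "vsmult x (vsmult (d ^ Suc e) g) = vsmult (d ^ e) (vsmult (d * x) g)"
      by (simp add: fun_eq_iff mult_ac)
    also have "\<dots> = (\<Sum>p<e. vsmult (d ^ e * a p) (f p))"
      unfolding a by (simp add: fun_eq_iff sum_fun_apply sum_distrib_left mult.assoc)
    also have "\<dots> = (\<Sum>p<e. vsmult (x * c p) (f p))" using c by (intro sum.cong) auto
    also have "\<dots> = vsmult x (\<Sum>p<e. vsmult (c p) (f p))"
      by (simp add: fun_eq_iff sum_fun_apply sum_distrib_left mult.assoc)
    finally have xeq: "vsmult x (vsmult (d ^ Suc e) g) = vsmult x (\<Sum>p<e. vsmult (c p) (f p))" .
    have "vsmult (d ^ Suc e) g = (\<Sum>p<e. vsmult (c p) (f p))"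
    proof
      fix i
      have "x * (vsmult (d ^ Suc e) g i - (\<Sum>p<e. vsmult (c p) (f p)) i) = 0"
        using fun_cong[OF xeq, of i] by (simp only: vsmult_apply right_diff_distrib) simp
      then have "vsmult (d ^ Suc e) g i - (\<Sum>p<e. vsmult (c p) (f p)) i = 0" by (rule x)
      then show "vsmult (d ^ Suc e) g i = (\<Sum>p<e. vsmult (c p) (f p)) i" by (rule eq_iff_diff_eq_0[THEN iffD2])
    qed
    also have "\<dots> \<in> mspan (f ` {..<e})"
      using subset_mspan[of "f ` {..<e}"] by (intro submod_sum submod_vsmult submod_mspan) auto
    finally show ?thesis using sub f by blast
  qed
  then show ?thesis unfolding ann_quot_def by blast
qed

text \<open>A minor \<open>d\<close> outside \<open>P\<close> leaves at most \<open>e\<close>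
  generators once \<open>d\<close> is inverted; the depth argument then puts a power of
  \<open>d\<close> into ann(G/E). The opposite inclusion is
  \<open>Fitting_not_subset_prime\<close>.\<close>

lemma Vset_fitting_wrt:
  fixes vs :: "('n::finite \<Rightarrow> 'a::comm_ring_1) list"
  assumes E: "E = mspan (set vs)" and grade: "2 \<le> grade_quot E"
  shows "Vset (fitting_wrt (card (UNIV :: 'n set)) vs) = Vset (ann_quot E)"
proof -
  let ?n = "length vs" and ?e = "card (UNIV :: 'n set)"
  define k where "k = ?n - ?e"
  have "\<exists>s\<in>ann_quot E. s \<notin> P"
    if P: "prime_ideal P" and F: "\<not> fitting_wrt ?e vs \<subseteq> P" for P
  proof (cases "ann_quot E = UNIV")
    \<comment> \<open>Here the grade is infinite by convention and supplies no regular sequence, but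
      1 is already a multiplier outside \<open>P\<close>.\<close>
    case True
    then show ?thesis using prime_ideal_one[OF P] by blast
  next
    case False
    obtain x y where xy: "x \<in> ann_quot E" "y \<in> ann_quot E" "\<And>z. x * z = 0 \<Longrightarrow> z = 0"
        "\<And>z w. y * z = x * w \<Longrightarrow> \<exists>t. z = x * t"
      using grade_ge_2E[OF grade[unfolded grade_quot_def] False] by blast
    let ?M = "{det (mat k k (\<lambda>(p, q). (rs ! p) (cs ! q))) | rs cs.
        length rs = k \<and> set rs \<subseteq> relations vs \<and> length cs = k \<and> set cs \<subseteq> {0..<?n}}"
    have "\<not> ?M \<subseteq> P"
      using F ideal_gen_minimal[OF prime_ideal_is_ideal[OF P], of ?M]
      unfolding fitting_wrt_def Let_def k_def[symmetric] by blast
    then obtain rs cs d where d: "d = det (mat k k (\<lambda>(p, q). (rs ! p) (cs ! q)))"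
      and rs: "length rs = k" "set rs \<subseteq> relations vs"
      and cs: "length cs = k" "set cs \<subseteq> {0..<?n}" and dP: "d \<notin> P" by blast
    have d0: "d \<noteq> 0" using dP ideal_0[OF prime_ideal_is_ideal[OF P]] by blast
    let ?J = "{..<?n} - set cs"
    note elim = minor_elimination[OF rs cs d d0]
    have "mspan ((!) vs ` ?J) \<subseteq> E" unfolding E by (intro mspan_mono) auto
    moreover have "card ?J \<le> ?e" unfolding elim(1) k_def by simp
    ultimately have "d ^ Suc ?e \<in> ann_quot E"
      using elim(2) by (intro power_mem_ann_quot[OF xy, where J = ?J and w = "(!) vs"]) (auto simp: E)
    then show ?thesis using prime_ideal_power[OF P dP] by blast
  qed
  then show ?thesis
    using Fitting_not_subset_prime[of _ _ vs] unfolding E[symmetric] Vset_def by blast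
qed

lemma Vset_Fitting:
  fixes E :: "('n::finite \<Rightarrow> 'a::comm_ring_1) set"
  assumes "fin_gen E" "2 \<le> grade_quot E"
  shows "Vset (Fitting (card (UNIV :: 'n set)) E) = Vset (ann_quot E)"
proof -
  obtain S where "finite S" "E = mspan S" using assms(1) unfolding fin_gen_def by blast
  \<comment> \<open>Ensures that the \<open>SOME\<close> in \<open>Fitting\<close> picks an actual
    generating list.\<close>
  then have "\<exists>vs. E = mspan (set vs)" using finite_list by blast
  then have "E = mspan (set (SOME vs. E = mspan (set vs)))" by (rule someI_ex)
  from Vset_fitting_wrt[OF this assms(2)] show ?thesis unfolding Fitting_def .
qed

lemma is_ideal_Fitting: "is_ideal (Fitting i E)"
  unfolding Fitting_def fitting_wrt_def Let_def by (rule is_ideal_ideal_gen)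

text \<open>Makes (a), (b) and (c) interchangeable, \<open>E\<close> being a reduction of
  itself.\<close>

lemma grade_quot_reduction:
  fixes E :: "('n::finite \<Rightarrow> 'a::comm_ring_1) set"
  assumes "submod E" "reduction U E"
  shows "grade_quot U = grade_quot E"
  unfolding grade_quot_def
proof (rule grade_eq_of_Vset_eq)
  show "is_ideal (ann_quot U)" "is_ideal (ann_quot E)"
    using assms is_ideal_ann_quot unfolding reduction_def by auto
qed (rule Vset_ann_quot_reduction[OF assms(2)])

theorem theorem3p6:
  fixes E :: "('n::finite \<Rightarrow> 'a::comm_ring_1) set"
  assumes "noetherian_ring TYPE('a)"
    and "submod E" and "fin_gen E" and "torsionfree E" and "rank_full E"
  shows "(grade_quot E \<ge> 2 \<longleftrightarrow> (\<forall>U. reduction U E \<longrightarrow> grade_quot U \<ge> 2))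
       \<and> ((\<forall>U. reduction U E \<longrightarrow> grade_quot U \<ge> 2) \<longleftrightarrow> (\<exists>U. reduction U E \<and> grade_quot U \<ge> 2))
       \<and> (grade_quot E \<ge> 2 \<longrightarrow>
           (\<forall>U. reduction U E \<longrightarrow>
              Vset (Fitting (card (UNIV::'n set)) E) = Vset (Fitting (card (UNIV::'n set)) U)
            \<and> Vset (Fitting (card (UNIV::'n set)) U) = Supp_quot E
            \<and> Supp_quot E = Supp_quot U
            \<and> grade_quot E = grade (Fitting (card (UNIV::'n set)) E)
            \<and> grade (Fitting (card (UNIV::'n set)) E) = grade (Fitting (card (UNIV::'n set)) U)
            \<and> grade (Fitting (card (UNIV::'n set)) U) = grade_quot U))"
proof (intro conjI)
  let ?F = "Fitting (card (UNIV::'n set))"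
  note grade_eq = grade_quot_reduction[OF assms(2)]
  show "2 \<le> grade_quot E \<longleftrightarrow> (\<forall>U. reduction U E \<longrightarrow> 2 \<le> grade_quot U)"
    and "(\<forall>U. reduction U E \<longrightarrow> 2 \<le> grade_quot U) \<longleftrightarrow> (\<exists>U. reduction U E \<and> 2 \<le> grade_quot U)"
    using grade_eq reduction_refl[OF assms(2)] by metis+
  show "2 \<le> grade_quot E \<longrightarrow> (\<forall>U. reduction U E \<longrightarrow>
      Vset (?F E) = Vset (?F U) \<and> Vset (?F U) = Supp_quot E \<and> Supp_quot E = Supp_quot U \<and>
      grade_quot E = grade (?F E) \<and> grade (?F E) = grade (?F U) \<and> grade (?F U) = grade_quot U)"
  proof (intro impI allI)
    fix U assume grade: "2 \<le> grade_quot E" and red: "reduction U E"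
    have U: "submod U" using red unfolding reduction_def by blast
    have FE: "Vset (?F E) = Vset (ann_quot E)" by (rule Vset_Fitting[OF assms(3) grade])
    \<comment> \<open>\<open>U\<close> inherits the grade bound from \<open>E\<close>, and finite
      generation from the Noetherian property, so the result on Fitting ideals applies to it as
      well.\<close>
    have FU: "Vset (?F U) = Vset (ann_quot U)"
      using grade grade_eq[OF red] by (intro Vset_Fitting fin_gen_submod assms(1) U) simp
    have gE: "grade (?F E) = grade_quot E" and gU: "grade (?F U) = grade_quot U"
      unfolding grade_quot_def
      by (intro grade_eq_of_Vset_eq is_ideal_Fitting is_ideal_ann_quot assms(2) U FE FU)+
    show "Vset (?F E) = Vset (?F U) \<and> Vset (?F U) = Supp_quot E \<and> Supp_quot E = Supp_quot U \<and>
      grade_quot E = grade (?F E) \<and> grade (?F E) = grade (?F U) \<and> grade (?F U) = grade_quot U"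
      using FE FU gE gU grade_eq[OF red] Vset_ann_quot_reduction[OF red]
        Supp_quot_eq_Vset_ann_quot[OF assms(2)] Supp_quot_eq_Vset_ann_quot[OF U] by simp
  qed
qed

end
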